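(* For every integer $k>1$, there is a graph $G$ with treewidth $k$ and local queue number at least $\lceil k/2\rceil+1$.
   Context: Graphs are finite, simple and undirected. Given a linear ordering $\prec$ of the vertex set of a graph, two edges $uv$ and $xy$ nest if $u \prec x \prec y \prec v$ or $x \prec u \prec v \prec y$ (for the endpoints named suitably). A queue is a set of edges no two of which nest. A queue layout of $G$ consists of a linear ordering $\prec$ of $V(G)$ and a partition of $E(G)$ into queues; it is $\ell$-local if every vertex has incident edges in at most $\ell$ queues (the total number of queues being arbitrary). The local queue number of $G$ is the smallest $\ell$ such that $G$ has an $\ell$-local queue layout. *)

theory Defs
  imports Complex_Main "HOL-Library.Disjoint_Sets"
begin

definition simple_graph :: "'a set \<Rightarrow> 'a set set \<Rightarrow> bool" where
  "simple_graph V E \<longleftrightarrow> finite V \<and> (\<forall>e\<in>E. e \<subseteq> V \<and> card e = 2)"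

definition walk_in :: "'a set \<Rightarrow> 'a set set \<Rightarrow> 'a list \<Rightarrow> bool" where
  "walk_in S E xs \<longleftrightarrow>
     xs \<noteq> [] \<and> set xs \<subseteq> S \<and> successively (\<lambda>x y. {x, y} \<in> E) xs"

text \<open>Connectedness of the subgraph induced by \<open>S\<close>; the null graph is not connected.\<close>

definition connected_in :: "'a set \<Rightarrow> 'a set set \<Rightarrow> bool" where
  "connected_in S E \<longleftrightarrow>
     S \<noteq> {} \<and> (\<forall>u\<in>S. \<forall>v\<in>S. \<exists>xs. walk_in S E xs \<and> hd xs = u \<and> last xs = v)"

definition cycle_in :: "'a set \<Rightarrow> 'a set set \<Rightarrow> 'a list \<Rightarrow> bool" where
  "cycle_in S E xs \<longleftrightarrow>
     walk_in S E xs \<and> distinct xs \<and> 3 \<le> length xs \<and> {last xs, hd xs} \<in> E"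

definition tree_graph :: "'a set \<Rightarrow> 'a set set \<Rightarrow> bool" where
  "tree_graph T F \<longleftrightarrow>
     simple_graph T F \<and> connected_in T F \<and> (\<nexists>xs. cycle_in T F xs)"

definition tree_decomposition ::
    "'a set \<Rightarrow> 'a set set \<Rightarrow> 't set \<Rightarrow> 't set set \<Rightarrow> ('t \<Rightarrow> 'a set) \<Rightarrow> bool" where
  "tree_decomposition V E T F B \<longleftrightarrow>
     tree_graph T F \<and>
     (\<forall>t\<in>T. B t \<subseteq> V) \<and>
     (\<forall>e\<in>E. \<exists>t\<in>T. e \<subseteq> B t) \<and>
     (\<forall>v\<in>V. connected_in {t \<in> T. v \<in> B t} F)"

definition decomposition_width :: "'t set \<Rightarrow> ('t \<Rightarrow> 'a set) \<Rightarrow> nat" where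
  "decomposition_width T B = Max ((\<lambda>t. card (B t)) ` T) - 1"

text \<open>
  Trees are finite, so natural numbers suffice as tree nodes. Because of truncated
  subtraction the null graph gets treewidth \<open>0\<close>, rather than \<open>-1\<close>.
\<close>

definition treewidth :: "'a set \<Rightarrow> 'a set set \<Rightarrow> nat" where
  "treewidth V E =
     (LEAST w. \<exists>(T :: nat set) F B.
        tree_decomposition V E T F B \<and> decomposition_width T B = w)"

text \<open>
  A vertex ordering is a reflexive relation satisfying \<^const>\<open>linear_order_on\<close>;
  \<open>precedes r\<close> is its strict part.
\<close>

definition precedes :: "'a rel \<Rightarrow> 'a \<Rightarrow> 'a \<Rightarrow> bool" where
  "precedes r u v \<longleftrightarrow> (u, v) \<in> r \<and> u \<noteq> v"

definition nest :: "'a rel \<Rightarrow> 'a set \<Rightarrow> 'a set \<Rightarrow> bool" where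
  "nest r e f \<longleftrightarrow>
     (\<exists>u v x y. e = {u, v} \<and> f = {x, y} \<and>
        (precedes r u x \<and> precedes r x y \<and> precedes r y v \<or>
         precedes r x u \<and> precedes r u v \<and> precedes r v y))"

definition is_queue :: "'a rel \<Rightarrow> 'a set set \<Rightarrow> bool" where
  "is_queue r Q \<longleftrightarrow> (\<forall>e\<in>Q. \<forall>f\<in>Q. \<not> nest r e f)"

definition queue_layout :: "'a set \<Rightarrow> 'a set set \<Rightarrow> 'a rel \<Rightarrow> 'a set set set \<Rightarrow> bool" where
  "queue_layout V E r P \<longleftrightarrow>
     linear_order_on V r \<and> partition_on E P \<and> (\<forall>Q\<in>P. is_queue r Q)"

definition local_layout :: "'a set \<Rightarrow> 'a set set set \<Rightarrow> nat \<Rightarrow> bool" where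
  "local_layout V P l \<longleftrightarrow> (\<forall>v\<in>V. card {Q \<in> P. \<exists>e\<in>Q. v \<in> e} \<le> l)"

definition local_queue_number :: "'a set \<Rightarrow> 'a set set \<Rightarrow> nat" where
  "local_queue_number V E =
     (LEAST l. \<exists>r P. queue_layout V E r P \<and> local_layout V P l)"

end

theory Submission
  imports Defs
begin

text \<open>
  Start with a clique \<open>C\<close> on \<open>k\<close> vertices and twice give every \<open>k\<close>-clique of the current
  graph many new common neighbours. Put \<open>l = \<lceil>k/2\<rceil>\<close> and suppose that there is an \<open>l\<close>-local
  layout. By the pigeonhole principle some of the common neighbours \<open>a \<prec> b \<prec> d\<close> of \<open>C\<close>
  lie on the same side of each \<open>c \<in> C\<close>, and the edges from \<open>c\<close> to them are in one queue.
  Two vertices of \<open>C\<close> on the same side have different queues, so at most \<open>l\<close> of them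
  are on each side, and exactly \<open>l\<close> on one side, say the left. Their queues are then all the
  queues at \<open>b\<close>, which forces the other neighbours of \<open>b\<close> outside \<open>C\<close> to the right of \<open>b\<close>. If
  \<open>c\<close> is a vertex of \<open>C\<close> on the right, then the clique \<open>C - c + b\<close> has \<open>l + 1\<close> vertices to the
  left of its new common neighbours, too many by the same argument.
\<close>

subsection \<open>Trees\<close>

definition adj :: "'a set \<Rightarrow> 'a set set \<Rightarrow> 'a rel" where
  "adj S E = {(x, y). x \<in> S \<and> y \<in> S \<and> {x, y} \<in> E}"

lemma walk_in_Cons:
  "walk_in S E (x # xs) \<longleftrightarrow> x \<in> S \<and> (xs = [] \<or> {x, hd xs} \<in> E \<and> walk_in S E xs)"
  by (auto simp: walk_in_def successively_Cons)

lemma walk_in_imp_adj: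
  "walk_in S E xs \<Longrightarrow> (hd xs, last xs) \<in> (adj S E)\<^sup>*"
proof (induction xs)
  case (Cons x xs)
  show ?case
  proof (cases "xs = []")
    case False
    with Cons.prems have *: "x \<in> S" "{x, hd xs} \<in> E" "walk_in S E xs"
      by (auto simp: walk_in_Cons)
    then have "(x, hd xs) \<in> adj S E"
      using False by (auto simp: adj_def walk_in_def)
    with Cons.IH * show ?thesis
      using False by (simp add: converse_rtrancl_into_rtrancl)
  qed simp
qed (simp add: walk_in_def)

text \<open>The closure is reflexive on every vertex, also outside \<open>S\<close>, while a walk
  stays inside \<open>S\<close>; hence the assumption \<open>v \<in> S\<close>.\<close>

lemma adj_imp_walk_in:
  assumes "(u, v) \<in> (adj S E)\<^sup>*" "v \<in> S"
  shows "\<exists>xs. walk_in S E xs \<and> hd xs = u \<and> last xs = v"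
  using assms
proof (induction rule: converse_rtrancl_induct)
  case base
  then show ?case by (intro exI[of _ "[v]"]) (simp add: walk_in_def)
next
  case (step y z)
  then obtain xs where "walk_in S E xs" "hd xs = z" "last xs = v" by blast
  with step.hyps(1) show ?case
    by (intro exI[of _ "y # xs"]) (auto simp: walk_in_Cons adj_def, auto simp: walk_in_def)
qed

text \<open>Replaces explicit walks by a reflexive transitive closure, whose induction and case
  rules carry the later connectedness arguments.\<close>

lemma connected_in_iff:
  "connected_in S E \<longleftrightarrow> S \<noteq> {} \<and> (\<forall>u\<in>S. \<forall>v\<in>S. (u, v) \<in> (adj S E)\<^sup>*)"
  unfolding connected_in_def using walk_in_imp_adj adj_imp_walk_in by metis

text \<open>Each step of a chain is collapsed or sent to an edge, so chains map to chains. This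
  serves for folding a leaf onto its neighbour and, with the identity map, for enlarging the edge
  set.\<close>

lemma connected_in_retract:
  assumes S: "connected_in S E" and img: "\<rho> ` S = S'"
    and step: "\<And>x y. (x, y) \<in> adj S E \<Longrightarrow> \<rho> x = \<rho> y \<or> {\<rho> x, \<rho> y} \<in> E'"
  shows "connected_in S' E'"
proof -
  have *: "(\<rho> u, \<rho> v) \<in> (adj S' E')\<^sup>*" if "(u, v) \<in> (adj S E)\<^sup>*" for u v
    using that
  proof induction
    case (step y z)
    have "\<rho> y = \<rho> z \<or> (\<rho> y, \<rho> z) \<in> adj S' E'"
      using assms(3)[OF step.hyps(2)] step.hyps(2) img by (auto simp: adj_def)
    with step.IH show ?case by (auto intro: rtrancl_into_rtrancl)
  qed simp
  show ?thesis
    using S * img unfolding connected_in_iff by blast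
qed

lemma simple_graph_edgeD: "simple_graph V E \<Longrightarrow> {x, y} \<in> E \<Longrightarrow> x \<in> V \<and> y \<in> V \<and> x \<noteq> y"
  by (auto simp: simple_graph_def)

lemma finite_edges: "simple_graph V E \<Longrightarrow> finite E"
  by (rule finite_subset[of _ "Pow V"]) (auto simp: simple_graph_def)

text \<open>The leaf is the first vertex of a longest path.\<close>

lemma tree_graph_leaf:
  assumes T: "tree_graph T F" and two: "x \<in> T" "y \<in> T" "x \<noteq> y"
  obtains t s where "t \<in> T" "s \<in> T" "t \<noteq> s" "\<And>z. {t, z} \<in> F \<Longrightarrow> z = s"
proof -
  have simple: "simple_graph T F" and conn: "connected_in T F"
    and acyc: "\<And>xs. \<not> cycle_in T F xs"
    using T by (auto simp: tree_graph_def)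
  have finT: "finite T" using simple by (simp add: simple_graph_def)
  let ?path = "\<lambda>xs. walk_in T F xs \<and> distinct xs"
  \<comment> \<open>A path repeats no vertex, so path lengths are bounded and a longest path
    exists.\<close>
  have bound: "length xs < Suc (card T)" if "?path xs" for xs
    using that finT by (metis walk_in_def card_mono distinct_card less_Suc_eq_le)
  obtain z where xz: "{x, z} \<in> F" "z \<in> T"
  proof -
    have "(x, y) \<in> (adj T F)\<^sup>*" using conn two by (simp add: connected_in_iff)
    then show ?thesis
      using two(3) that by (cases rule: converse_rtranclE) (auto simp: adj_def)
  qed
  have "?path [x, z]"
    using xz two simple_graph_edgeD[OF simple] by (auto simp: walk_in_def)
  then obtain xs where xs: "?path xs" and longest: "\<And>ys. ?path ys \<Longrightarrow> length ys \<le> length xs"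
    using ex_has_greatest_nat[of ?path "[x, z]" length "Suc (card T)"] bound by blast
  have len: "2 \<le> length xs" using longest[OF \<open>?path [x, z]\<close>] by simp
  then obtain t s zs where ts: "xs = t # s # zs"
    by (cases xs; cases "tl xs") auto
  show thesis
  proof
    show "t \<in> T" "s \<in> T" "t \<noteq> s" using xs ts by (auto simp: walk_in_def)
    fix u assume u: "{t, u} \<in> F"
    then have uT: "u \<in> T" "u \<noteq> t" using simple_graph_edgeD[OF simple u] by auto
    show "u = s"
    proof (rule ccontr)
      assume "u \<noteq> s"
      show False
      proof (cases "u \<in> set xs")
        case False
        then have "?path (u # xs)"
          using xs u uT ts by (auto simp: walk_in_Cons insert_commute)
        then show False using longest by fastforce
      next
        case True
        \<comment> \<open>Here \<open>u\<close> lies on the path beyond \<open>s\<close>, and the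
          edge back to \<open>t\<close> closes the initial segment up to \<open>u\<close> into a
          cycle.\<close>
        then obtain ps qs where zs: "zs = ps @ u # qs"
          using ts uT \<open>u \<noteq> s\<close> by (auto dest: split_list)
        have "cycle_in T F (t # s # ps @ [u])"
          using xs u unfolding ts zs cycle_in_def walk_in_def
          by (auto simp: successively_append_iff successively_Cons insert_commute hd_append)
        then show False using acyc by blast
      qed
    qed
  qed
qed

text \<open>The Helly property of subtrees, by induction on the number of nodes. Remove a leaf
  \<open>t\<close> with neighbour \<open>s\<close>: unless some \<open>S v\<close> is
  \<open>{t}\<close>, every \<open>S v\<close> containing \<open>t\<close> also contains
  \<open>s\<close>, so the subtrees stay connected and pairwise intersecting without
  \<open>t\<close>.\<close>

lemma subtrees_Helly:
  assumes "tree_graph T F" "\<And>v. v \<in> K \<Longrightarrow> S v \<subseteq> T \<and> connected_in (S v) F"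
    and "\<And>u v. u \<in> K \<Longrightarrow> v \<in> K \<Longrightarrow> S u \<inter> S v \<noteq> {}"
  shows "\<exists>t\<in>T. \<forall>v\<in>K. t \<in> S v"
  using assms
proof (induction "card T" arbitrary: T F S rule: less_induct)
  case less
  have simple: "simple_graph T F" and conn: "connected_in T F"
    and acyc: "\<And>xs. \<not> cycle_in T F xs"
    using less.prems(1) by (auto simp: tree_graph_def)
  have finT: "finite T" using simple by (simp add: simple_graph_def)
  obtain x where x: "x \<in> T" using conn by (auto simp: connected_in_def)
  show ?case
  proof (cases "T = {x}")
    case True
    then show ?thesis using less.prems(2,3) by blast
  next
    case False
    then obtain y where "y \<in> T" "x \<noteq> y" using x by blast
    with less.prems(1) x obtain t s where ts: "t \<in> T" "s \<in> T" "t \<noteq> s"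
      and leaf: "\<And>z. {t, z} \<in> F \<Longrightarrow> z = s"
      by (metis tree_graph_leaf)
    show ?thesis
    proof (cases "\<exists>v\<in>K. S v = {t}")
      case True
      \<comment> \<open>Every subtree meets \<open>{t}\<close>, so \<open>t\<close> itself is the
        common node.\<close>
      then show ?thesis using less.prems(3) ts(1) by (metis Int_insert_left_if0 Int_empty_left)
    next
      case False
      \<comment> \<open>Folding \<open>t\<close> onto \<open>s\<close> collapses the only edge at
        \<open>t\<close>.\<close>
      define \<rho> where "\<rho> = (\<lambda>z. if z = t then s else z)"
      define F' where "F' = {e \<in> F. t \<notin> e}"
      have retract: "connected_in (U - {t}) F'"
        if U: "connected_in U F" "U \<subseteq> T" and s: "t \<in> U \<Longrightarrow> s \<in> U" for U
      proof (rule connected_in_retract[OF U(1)])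
        show "\<rho> ` U = U - {t}" using s ts(3) by (auto simp: \<rho>_def image_iff)
        fix a b assume "(a, b) \<in> adj U F"
        then show "\<rho> a = \<rho> b \<or> {\<rho> a, \<rho> b} \<in> F'"
          using leaf[of a] leaf[of b] by (auto simp: \<rho>_def F'_def adj_def insert_commute)
      qed
      have s_in: "s \<in> S v" if v: "v \<in> K" "t \<in> S v" for v
      proof -
        obtain z where "z \<in> S v" "z \<noteq> t" using False v by blast
        \<comment> \<open>A chain inside \<open>S v\<close> that leaves the leaf \<open>t\<close>
          must take its first step to \<open>s\<close>.\<close>
        then have "(t, z) \<in> (adj (S v) F)\<^sup>*"
          using less.prems(2)[OF v(1)] v(2) by (auto simp: connected_in_iff)
        then show ?thesis
          using \<open>z \<noteq> t\<close> leaf by (cases rule: converse_rtranclE) (auto simp: adj_def)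
      qed
      have tree': "tree_graph (T - {t}) F'"
        unfolding tree_graph_def
      proof (intro conjI)
        show "simple_graph (T - {t}) F'" using simple by (auto simp: simple_graph_def F'_def)
        show "connected_in (T - {t}) F'" using retract[OF conn] ts by simp
        have "cycle_in T F xs" if "cycle_in (T - {t}) F' xs" for xs
          using that unfolding cycle_in_def walk_in_def F'_def
          by (auto elim: successively_mono)
        then show "\<nexists>xs. cycle_in (T - {t}) F' xs" using acyc by blast
      qed
      have "\<exists>u\<in>T - {t}. \<forall>v\<in>K. u \<in> S v - {t}"
      proof (rule less.hyps[OF _ tree'])
        show "card (T - {t}) < card T" using ts(1) finT by (rule card_Diff1_less[rotated])
        show "S v - {t} \<subseteq> T - {t} \<and> connected_in (S v - {t}) F'" if "v \<in> K" for v
          using retract[of "S v"] less.prems(2)[OF that] s_in[OF that] by blast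
        show "(S u - {t}) \<inter> (S v - {t}) \<noteq> {}" if "u \<in> K" "v \<in> K" for u v
          using less.prems(3)[OF that] s_in that ts(3) by blast
      qed
      then show ?thesis by blast
    qed
  qed
qed

section \<open>Cliques and bags\<close>

definition clique :: "'a set set \<Rightarrow> 'a set \<Rightarrow> bool" where
  "clique E K \<longleftrightarrow> (\<forall>u\<in>K. \<forall>v\<in>K. u \<noteq> v \<longrightarrow> {u, v} \<in> E)"

text \<open>The nodes whose bags contain a given vertex form a subtree. For two vertices of
  \<open>K\<close> these subtrees meet, since some bag contains the edge between them; the Helly
  property then gives a common node.\<close>

lemma clique_in_bag:
  assumes dec: "tree_decomposition V E T F B" and K: "clique E K" "K \<subseteq> V"
  shows "\<exists>t\<in>T. K \<subseteq> B t"
proof -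
  have "\<exists>t\<in>T. \<forall>v\<in>K. t \<in> {t \<in> T. v \<in> B t}"
  proof (rule subtrees_Helly)
    show "tree_graph T F" using dec by (simp add: tree_decomposition_def)
    show "{t \<in> T. v \<in> B t} \<subseteq> T \<and> connected_in {t \<in> T. v \<in> B t} F" if "v \<in> K" for v
      using dec K(2) that by (auto simp: tree_decomposition_def)
    show "{t \<in> T. u \<in> B t} \<inter> {t \<in> T. v \<in> B t} \<noteq> {}" if uv: "u \<in> K" "v \<in> K" for u v
    proof (cases "u = v")
      case True
      have "connected_in {t \<in> T. v \<in> B t} F"
        using dec K(2) uv(2) by (auto simp: tree_decomposition_def)
      with True show ?thesis by (simp add: connected_in_def)
    next
      case False
      then have "{u, v} \<in> E" using K(1) uv by (simp add: clique_def)
      then obtain t where "t \<in> T" "{u, v} \<subseteq> B t"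
        using dec unfolding tree_decomposition_def by meson
      then show ?thesis by blast
    qed
  qed
  then show ?thesis by blast
qed

section \<open>Adding a leaf to a tree\<close>

lemma connected_in_insert:
  assumes S: "connected_in S F" and st: "s \<in> S" "{t, s} \<in> F'" "F \<subseteq> F'"
  shows "connected_in (insert t S) F'"
proof -
  let ?A = "adj (insert t S) F'"
  have sub: "adj S F \<subseteq> ?A" using st by (auto simp: adj_def)
  have ts: "(t, s) \<in> ?A" "(s, t) \<in> ?A" using st by (auto simp: adj_def insert_commute)
  have SS: "(u, v) \<in> ?A\<^sup>*" if "u \<in> S" "v \<in> S" for u v
    using S that rtrancl_mono[OF sub] by (auto simp: connected_in_iff)
  have "(u, s) \<in> ?A\<^sup>*" "(s, u) \<in> ?A\<^sup>*" if "u \<in> insert t S" for u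
    using that SS st(1) ts by auto
  then show ?thesis unfolding connected_in_iff by (meson insert_not_empty rtrancl_trans)
qed

text \<open>On a cycle through \<open>t\<close> the two vertices next to \<open>t\<close> would be
  distinct, but \<open>s\<close> is the only neighbour of \<open>t\<close>. A cycle avoiding
  \<open>t\<close> lies in the old tree.\<close>

lemma tree_graph_add_leaf:
  assumes T: "tree_graph T F" and st: "s \<in> T" "t \<notin> T"
  shows "tree_graph (insert t T) (insert {t, s} F)"
  unfolding tree_graph_def
proof (intro conjI notI)
  have simple: "simple_graph T F" and acyc: "\<And>xs. \<not> cycle_in T F xs"
    using T by (auto simp: tree_graph_def)
  have st': "s \<noteq> t" using st by blast
  have tF: "e \<in> F \<Longrightarrow> t \<notin> e" for e using simple st by (auto simp: simple_graph_def)
  show "simple_graph (insert t T) (insert {t, s} F)"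
    using simple st st' by (auto simp: simple_graph_def)
  show "connected_in (insert t T) (insert {t, s} F)"
    using T st by (intro connected_in_insert[of T F]) (auto simp: tree_graph_def)
  have nbr: "z = s" if "{t, z} \<in> insert {t, s} F" for z
    using that tF by (auto simp: doubleton_eq_iff)
  assume "\<exists>xs. cycle_in (insert t T) (insert {t, s} F) xs"
  then obtain xs where xs: "cycle_in (insert t T) (insert {t, s} F) xs" by blast
  then have dist: "distinct xs" and len: "3 \<le> length xs"
    and succ: "successively (\<lambda>x y. {x, y} \<in> insert {t, s} F) xs"
    and wrap: "{last xs, hd xs} \<in> insert {t, s} F"
    and sub: "set xs \<subseteq> insert t T"
    by (auto simp: cycle_in_def walk_in_def)
  show False
  proof (cases "t \<in> set xs")
    case True
    then obtain ps qs where split: "xs = ps @ t # qs" by (auto dest: split_list)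
    show False
    proof (cases "ps = []")
      case True
      then have "qs \<noteq> []" using len split by auto
      then have "{t, hd qs} \<in> insert {t, s} F" "{t, last qs} \<in> insert {t, s} F"
        using succ wrap split True
        by (simp_all add: successively_Cons insert_commute)
      then have "hd qs = last qs" using nbr by metis
      then show False
        using dist len split True by (cases qs; cases "tl qs") (auto split: if_splits)
    next
      case ps: False
      then have p: "last ps = s"
        using succ split nbr by (simp add: successively_append_iff insert_commute)
      \<comment> \<open>This is the cyclic successor of \<open>t\<close>: the head of
        \<open>qs\<close>, or the head of \<open>ps\<close> if \<open>t\<close> is last in the
        list.\<close>
      have "hd (qs @ ps) = s"
      proof (cases "qs = []")
        case True
        then show ?thesis using wrap split ps nbr by simp
      next
        case False
        then show ?thesis
          using succ split nbr by (simp add: successively_append_iff successively_Cons)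
      qed
      with p ps dist len split show False
        by (cases qs; cases ps; cases "tl ps") (auto split: if_splits)
    qed
  next
    case False
    have "successively (\<lambda>x y. {x, y} \<in> F) xs"
      using succ by (rule successively_mono) (use False in \<open>auto simp: doubleton_eq_iff\<close>)
    moreover have "{last xs, hd xs} \<in> F"
      using wrap False len by (metis doubleton_eq_iff hd_in_set insertE last_in_set list.size(3) not_numeral_le_zero)
    ultimately have "cycle_in T F xs"
      using sub dist len False by (auto simp: cycle_in_def walk_in_def)
    then show False using acyc by blast
  qed
qed

subsection \<open>Graphs of bounded treewidth\<close>

text \<open>A bound on bag sizes can be carried through the construction of the graph; minimality
  over all decompositions is then settled once, for the finished graph.\<close>

definition tw_at_most :: "nat \<Rightarrow> 'a set \<Rightarrow> 'a set set \<Rightarrow> bool" where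
  "tw_at_most k V E \<longleftrightarrow> simple_graph V E \<and>
     (\<exists>(T :: nat set) F B. tree_decomposition V E T F B \<and> (\<forall>t\<in>T. card (B t) \<le> k + 1))"

text \<open>The given decomposition yields the upper bound. In any decomposition the clique fits
  into one bag, which therefore has at least \<open>k + 1\<close> vertices.\<close>

lemma treewidth_eqI:
  assumes tw: "tw_at_most k V E" and K: "clique E K" "K \<subseteq> V" "card K = k + 1"
  shows "treewidth V E = k"
proof -
  have finV: "finite V" using tw by (simp add: tw_at_most_def simple_graph_def)
  obtain T :: "nat set" and F B where dec: "tree_decomposition V E T F B"
    and small: "\<And>t. t \<in> T \<Longrightarrow> card (B t) \<le> k + 1"
    using tw by (auto simp: tw_at_most_def)
  have lower: "k \<le> decomposition_width T B"
    if dec: "tree_decomposition V E T F B" for T :: "nat set" and F B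
  proof -
    have "finite T" and B: "\<And>t. t \<in> T \<Longrightarrow> B t \<subseteq> V"
      using dec by (auto simp: tree_decomposition_def tree_graph_def simple_graph_def)
    obtain t where t: "t \<in> T" "K \<subseteq> B t" using clique_in_bag[OF dec K(1,2)] by blast
    then have "k + 1 \<le> card (B t)"
      using K(3) card_mono[OF finite_subset[OF B finV]] by metis
    also have "\<dots> \<le> Max ((\<lambda>t. card (B t)) ` T)"
      using t(1) \<open>finite T\<close> by (intro Max_ge) auto
    finally show ?thesis by (simp add: decomposition_width_def)
  qed
  have "finite T" "T \<noteq> {}"
    using dec by (auto simp: tree_decomposition_def tree_graph_def simple_graph_def connected_in_def)
  then have "Max ((\<lambda>t. card (B t)) ` T) \<le> k + 1"
    using small by (subst Max_le_iff) auto
  then have "decomposition_width T B = k"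
    using lower[OF dec] by (simp add: decomposition_width_def)
  with dec show ?thesis
    unfolding treewidth_def by (intro Least_equality) (use lower in blast)+
qed

lemma tw_at_most_complete:
  assumes "finite V" "V \<noteq> {}" "card V \<le> k + 1"
  shows "tw_at_most k V {e. e \<subseteq> V \<and> card e = 2}"
  unfolding tw_at_most_def
proof (intro conjI exI)
  show "simple_graph V {e. e \<subseteq> V \<and> card e = 2}"
    using assms(1) by (auto simp: simple_graph_def)
  have "connected_in {0::nat} {}" by (simp add: connected_in_iff)
  moreover have "\<not> cycle_in {0::nat} {} xs" for xs
    by (auto simp: cycle_in_def)
  ultimately show "tree_decomposition V {e. e \<subseteq> V \<and> card e = 2} {0::nat} {} (\<lambda>_. V)"
    by (auto simp: tree_decomposition_def tree_graph_def simple_graph_def)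
  show "\<forall>t\<in>{0}. card V \<le> k + 1" using assms(3) by simp
qed

text \<open>Some bag \<open>B s\<close> contains the clique \<open>K\<close>; a new leaf at
  \<open>s\<close> with bag \<open>insert v K\<close> covers all new edges.\<close>

lemma tw_at_most_add_vertex:
  assumes tw: "tw_at_most k V E" and K: "clique E K" "K \<subseteq> V" "card K \<le> k" and v: "v \<notin> V"
  shows "tw_at_most k (insert v V) (E \<union> (\<lambda>x. {v, x}) ` K)"
proof -
  let ?E = "E \<union> (\<lambda>x. {v, x}) ` K"
  have simple: "simple_graph V E" and finV: "finite V"
    using tw by (auto simp: tw_at_most_def simple_graph_def)
  obtain T :: "nat set" and F B where dec: "tree_decomposition V E T F B"
    and small: "\<And>t. t \<in> T \<Longrightarrow> card (B t) \<le> k + 1"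
    using tw by (auto simp: tw_at_most_def)
  have tree: "tree_graph T F" and BV: "\<And>t. t \<in> T \<Longrightarrow> B t \<subseteq> V"
    and edge: "\<And>e. e \<in> E \<Longrightarrow> \<exists>t\<in>T. e \<subseteq> B t"
    and conn: "\<And>u. u \<in> V \<Longrightarrow> connected_in {t \<in> T. u \<in> B t} F"
    using dec by (auto simp: tree_decomposition_def)
  have "finite T" using tree by (simp add: tree_graph_def simple_graph_def)
  then obtain t where t: "t \<notin> T" using ex_new_if_finite infinite_UNIV_nat by blast
  obtain s where s: "s \<in> T" "K \<subseteq> B s" using clique_in_bag[OF dec K(1,2)] by blast
  define B' where "B' = B(t := insert v K)"
  have B'T: "B' t' = B t'" if "t' \<in> T" for t' using that t by (auto simp: B'_def)
  have B't: "B' t = insert v K" by (simp add: B'_def)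
  have "tree_decomposition (insert v V) ?E (insert t T) (insert {t, s} F) B'"
    unfolding tree_decomposition_def
  proof (intro conjI ballI)
    show "tree_graph (insert t T) (insert {t, s} F)"
      using tree_graph_add_leaf[OF tree s(1) t] .
    show "B' t' \<subseteq> insert v V" if "t' \<in> insert t T" for t'
      using that BV[of t'] K(2) B'T[of t'] B't by blast
    show "\<exists>t\<in>insert t T. e \<subseteq> B' t" if "e \<in> ?E" for e
    proof (cases "e \<in> E")
      case True
      then obtain t' where "t' \<in> T" "e \<subseteq> B t'" using edge by blast
      then show ?thesis using B'T by (intro bexI[of _ t']) auto
    next
      case False
      then show ?thesis using that B't by auto
    qed
    fix u assume u: "u \<in> insert v V"
    show "connected_in {t' \<in> insert t T. u \<in> B' t'} (insert {t, s} F)"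
    proof (cases "u = v")
      case True
      have "v \<notin> B' t'" if "t' \<in> T" for t' using v BV[OF that] B'T[OF that] by blast
      with True have "{t' \<in> insert t T. u \<in> B' t'} = {t}"
        using B't by auto
      then show ?thesis by (simp add: connected_in_iff)
    next
      case False
      then have uV: "u \<in> V" using u by simp
      show ?thesis
      proof (cases "u \<in> K")
        case True
        then have "{t' \<in> insert t T. u \<in> B' t'} = insert t {t' \<in> T. u \<in> B t'}"
          using B'T B't by auto
        then show ?thesis
          using connected_in_insert[OF conn[OF uV], of s t "insert {t, s} F"] s True by auto
      next
        case out: False
        then have "{t' \<in> insert t T. u \<in> B' t'} = {t' \<in> T. u \<in> B t'}"
          using False B'T B't by auto
        moreover have "connected_in {t' \<in> T. u \<in> B t'} (insert {t, s} F)"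
          by (rule connected_in_retract[OF conn[OF uV], of id]) (auto simp: adj_def)
        ultimately show ?thesis by simp
      qed
    qed
  qed
  moreover have "card (B' t') \<le> k + 1" if "t' \<in> insert t T" for t'
  proof (cases "t' = t")
    case True
    have "card (insert v K) \<le> Suc (card K)" by (rule card_insert_le_m1) auto
    with True show ?thesis using K(3) B't by simp
  next
    case False
    then show ?thesis using that small B'T by simp
  qed
  moreover have "simple_graph (insert v V) ?E"
    using simple K(2) v by (auto simp: simple_graph_def card_insert_if)
  ultimately show ?thesis unfolding tw_at_most_def by blast
qed

section \<open>Attaching common neighbours to cliques\<close>

definition new_nbrs :: "nat \<Rightarrow> 'a set \<Rightarrow> 'a set \<Rightarrow> 'a set set \<Rightarrow> 'a set \<Rightarrow> bool" where
  "new_nbrs M V V' E' K \<longleftrightarrow>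
     (\<exists>W \<subseteq> V' - V. card W = M \<and> (\<forall>w\<in>W. \<forall>x\<in>K. {w, x} \<in> E'))"

lemma new_nbrs_mono:
  assumes "new_nbrs M V V' E' K" "U \<subseteq> V" "V' \<subseteq> V''" "E' \<subseteq> E''"
  shows "new_nbrs M U V'' E'' K"
proof -
  obtain W where "W \<subseteq> V' - V" "card W = M" "\<forall>w\<in>W. \<forall>x\<in>K. {w, x} \<in> E'"
    using assms(1) by (auto simp: new_nbrs_def)
  then show ?thesis
    unfolding new_nbrs_def using assms(2-4) by (intro exI[of _ W]) blast
qed

lemma tw_at_most_finite: "tw_at_most k V E \<Longrightarrow> finite V"
  by (simp add: tw_at_most_def simple_graph_def)

lemma clique_mono: "clique E K \<Longrightarrow> E \<subseteq> E' \<Longrightarrow> clique E' K"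
  by (auto simp: clique_def)

text \<open>The vertices are added one at a time, since \<open>K\<close> remains a clique as the
  graph grows. Natural numbers as vertices always leave a fresh one.\<close>

lemma add_common_nbrs:
  fixes V :: "nat set"
  assumes "tw_at_most k V E" "clique E K" "K \<subseteq> V" "card K \<le> k"
  shows "\<exists>V' E'. tw_at_most k V' E' \<and> V \<subseteq> V' \<and> E \<subseteq> E' \<and> new_nbrs M V V' E' K"
proof (induction M)
  case 0
  show ?case using assms(1) by (intro exI[of _ V] exI[of _ E]) (auto simp: new_nbrs_def)
next
  case (Suc M)
  then obtain V' E' W where G: "tw_at_most k V' E'" "V \<subseteq> V'" "E \<subseteq> E'"
    and W: "W \<subseteq> V' - V" "card W = M" "\<forall>w\<in>W. \<forall>x\<in>K. {w, x} \<in> E'"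
    by (auto simp: new_nbrs_def)
  have fin: "finite V'" using tw_at_most_finite[OF G(1)] .
  then obtain v where v: "v \<notin> V'" using ex_new_if_finite infinite_UNIV_nat by blast
  let ?E = "E' \<union> (\<lambda>x. {v, x}) ` K"
  have "tw_at_most k (insert v V') ?E"
    using tw_at_most_add_vertex[OF G(1) clique_mono[OF assms(2) G(3)] _ assms(4) v] assms(3) G(2)
    by blast
  moreover have "new_nbrs (Suc M) V (insert v V') ?E K"
    unfolding new_nbrs_def
  proof (intro exI[of _ "insert v W"] conjI)
    have "finite W" "v \<notin> W" using W(1) fin v finite_subset by auto
    then show "card (insert v W) = Suc M" using W(2) by simp
  qed (use W v G(2) in auto)
  ultimately show ?case
    using G(2,3) by (intro exI[of _ "insert v V'"] exI[of _ ?E]) blast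
qed

text \<open>The finitely many \<open>k\<close>-cliques of the old graph are served one after
  another; neighbours already attached survive later enlargements.\<close>

lemma add_common_nbrs_all:
  fixes V :: "nat set"
  assumes "tw_at_most k V E"
  obtains V' E' where "tw_at_most k V' E'" "V \<subseteq> V'" "E \<subseteq> E'"
    "\<And>K. clique E K \<Longrightarrow> K \<subseteq> V \<Longrightarrow> card K = k \<Longrightarrow> new_nbrs M V V' E' K"
proof -
  let ?\<K> = "{K. clique E K \<and> K \<subseteq> V \<and> card K = k}"
  have "\<exists>V' E'. tw_at_most k V' E' \<and> V \<subseteq> V' \<and> E \<subseteq> E' \<and> (\<forall>K\<in>\<C>. new_nbrs M V V' E' K)"
    if "finite \<C>" "\<C> \<subseteq> ?\<K>" for \<C>
    using that
  proof induction
    case empty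
    show ?case using assms by blast
  next
    case (insert K \<C>)
    then obtain V1 E1 where 1: "tw_at_most k V1 E1" "V \<subseteq> V1" "E \<subseteq> E1"
      "\<forall>K\<in>\<C>. new_nbrs M V V1 E1 K"
      by blast
    have K: "clique E K" "K \<subseteq> V" "card K = k" using insert.prems by auto
    obtain V2 E2 where 2: "tw_at_most k V2 E2" "V1 \<subseteq> V2" "E1 \<subseteq> E2" "new_nbrs M V1 V2 E2 K"
      using add_common_nbrs[OF 1(1) clique_mono[OF K(1) 1(3)], of M] K 1(2) by fastforce
    have "\<forall>K\<in>insert K \<C>. new_nbrs M V V2 E2 K"
      using 1 2 by (blast intro: new_nbrs_mono)
    then show ?case using 1 2 by (meson order_trans)
  qed
  moreover have "finite ?\<K>"
    using tw_at_most_finite[OF assms] by (simp add: finite_subset[of _ "Pow V"])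
  ultimately obtain V' E' where "tw_at_most k V' E'" "V \<subseteq> V'" "E \<subseteq> E'"
    "\<forall>K\<in>?\<K>. new_nbrs M V V' E' K"
    by (meson order_refl)
  then show thesis using that by blast
qed

subsection \<open>Queue layouts\<close>

lemma linear_order_rank:
  assumes lin: "linear_order_on V r" and fin: "finite V"
  obtains f :: "'a \<Rightarrow> int" where "inj_on f V"
    "\<And>u v. u \<in> V \<Longrightarrow> v \<in> V \<Longrightarrow> f u < f v \<Longrightarrow> precedes r u v"
proof -
  \<comment> \<open>The rank counts strict predecessors. Its values are integers so that negation
    can reverse the order.\<close>
  define f where "f u = int (card {x \<in> V. precedes r x u})" for u
  have tr: "precedes r x z" if "precedes r x y" "precedes r y z" for x y z
    using lin that
    by (metis antisymD linear_order_on_def partial_order_on_def precedes_def preorder_on_def transD)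
  have total: "precedes r u v \<or> precedes r v u" if "u \<in> V" "v \<in> V" "u \<noteq> v" for u v
    using lin that by (auto simp: linear_order_on_def total_on_def precedes_def)
  have mono: "f u < f v" if "u \<in> V" "precedes r u v" for u v
    unfolding f_def of_nat_less_iff
  proof (rule psubset_card_mono)
    have "\<not> precedes r u u" by (simp add: precedes_def)
    then show "{x \<in> V. precedes r x u} \<subset> {x \<in> V. precedes r x v}"
      using that tr by blast
  qed (use fin in simp)
  show thesis
  proof
    show "inj_on f V"
      using total mono by (force simp: inj_on_def)
    show "precedes r u v" if "u \<in> V" "v \<in> V" "f u < f v" for u v
      using total[of u v] mono[of v u] that by fastforce
  qed
qed

text \<open>If all fibres had at most \<open>m\<close> elements, \<open>S\<close> would have at most
  \<open>card D * m\<close>.\<close>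

lemma large_fibre:
  assumes fin: "finite S" and D: "g ` S \<subseteq> D" "finite D" and large: "card D * m < card S"
  obtains y where "m < card {x \<in> S. g x = y}"
proof (rule ccontr)
  assume "\<not> thesis"
  then have le: "card {x \<in> S. g x = y} \<le> m" for y using that by (meson not_le)
  have "S = (\<Union>y\<in>D. {x \<in> S. g x = y})" using D(1) by auto
  then have "card S \<le> (\<Sum>y\<in>D. card {x \<in> S. g x = y})"
    using card_UN_le[OF D(2)] by metis
  also have "\<dots> \<le> card D * m" using sum_bounded_above[of D _ m] le by simp
  finally show False using large by simp
qed

lemma three_increasing:
  fixes f :: "'a \<Rightarrow> int"
  assumes "inj_on f S" "2 < card S"
  obtains a b d where "a \<in> S" "b \<in> S" "d \<in> S" "f a < f b" "f b < f d"
proof -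
  have fin: "finite S" using assms(2) card.infinite by fastforce
  obtain T where "T \<subseteq> S" "card T = 3" using assms(2) obtain_subset_with_card_n[of 3 S] by auto
  then obtain x y z where "x \<in> S" "y \<in> S" "z \<in> S" and ne: "x \<noteq> y" "x \<noteq> z" "y \<noteq> z"
    by (auto simp: card_3_iff)
  moreover from this have "f x \<noteq> f y" "f x \<noteq> f z" "f y \<noteq> f z"
    using assms(1) by (auto dest: inj_onD)
  ultimately show thesis using that by (metis linorder_less_linear)
qed

text \<open>The vertex order is given by the values of \<open>f\<close>; negating \<open>f\<close> reverses it.\<close>

locale ordered_queues =
  fixes V :: "'a set" and E :: "'a set set" and P :: "'a set set set" and l :: nat
    and f :: "'a \<Rightarrow> int"
  assumes simple: "simple_graph V E" and finite_queues: "finite P"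
    and cover: "e \<in> E \<Longrightarrow> \<exists>Q\<in>P. e \<in> Q"
    and no_nest: "Q \<in> P \<Longrightarrow> {u, v} \<in> Q \<Longrightarrow> {x, y} \<in> Q \<Longrightarrow> f u < f x \<Longrightarrow> f x < f y \<Longrightarrow> \<not> f y < f v"
    and local: "v \<in> V \<Longrightarrow> card {Q \<in> P. \<exists>e\<in>Q. v \<in> e} \<le> l"
    and inj: "inj_on f V"
begin

definition queues_at :: "'a \<Rightarrow> 'a set set set" where
  "queues_at v = {Q \<in> P. \<exists>e\<in>Q. v \<in> e}"

lemma queues_atI: "Q \<in> P \<Longrightarrow> {u, v} \<in> Q \<Longrightarrow> Q \<in> queues_at u"
  unfolding queues_at_def by blast

lemma finite_queues_at: "finite (queues_at v)"
  unfolding queues_at_def using finite_queues by simp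

lemma card_queues_at: "v \<in> V \<Longrightarrow> card (queues_at v) \<le> l"
  unfolding queues_at_def by (rule local)

lemma finite_V: "finite V"
  using simple by (simp add: simple_graph_def)

text \<open>Reading the order backwards preserves nesting, with the endpoints of each edge
  exchanged. Statements about the left thereby yield statements about the right.\<close>

lemma reversed: "ordered_queues V E P l (\<lambda>x. - f x)"
proof
  fix Q u v x y
  assume "Q \<in> P" "{u, v} \<in> Q" "{x, y} \<in> Q" "- f u < - f x" "- f x < - f y"
  then show "\<not> - f y < - f v" using no_nest[of Q v u y x] by (auto simp: insert_commute)
qed (use simple finite_queues cover local inj in \<open>auto simp: inj_on_def\<close>)

text \<open>
  Three vertices that the layout does not distinguish as seen from \<open>C\<close>.
\<close>

definition homogeneous :: "'a set \<Rightarrow> ('a \<Rightarrow> 'a set set) \<Rightarrow> 'a \<Rightarrow> 'a \<Rightarrow> 'a \<Rightarrow> bool" where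
  "homogeneous C q a b d \<longleftrightarrow>
     a \<in> V \<and> b \<in> V \<and> d \<in> V \<and> C \<subseteq> V \<and> f a < f b \<and> f b < f d \<and>
     (\<forall>c\<in>C. q c \<in> P \<and> {c, a} \<in> q c \<and> {c, b} \<in> q c \<and> {c, d} \<in> q c \<and>
             (f c < f a \<or> f d < f c))"

text \<open>Colour each \<open>v\<close> in \<open>S\<close> by recording, for every
  \<open>c\<close> in \<open>C\<close>, the queue of \<open>cv\<close> and the side of
  \<open>c\<close>. More than twice as many vertices as colours leave three of one colour.\<close>

lemma homogeneous_triple:
  assumes S: "S \<subseteq> V" "S \<inter> C = {}" and C: "C \<subseteq> V"
    and edges: "\<And>v c. v \<in> S \<Longrightarrow> c \<in> C \<Longrightarrow> {v, c} \<in> E"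
    and large: "(2 * l) ^ card C * 2 < card S"
  obtains q a b d where "a \<in> S" "b \<in> S" "d \<in> S" "homogeneous C q a b d"
proof -
  have fin: "finite C" "finite S" using finite_V C S(1) by (auto intro: finite_subset)
  have "\<forall>e\<in>E. \<exists>Q. Q \<in> P \<and> e \<in> Q" using cover by blast
  then obtain Qof where Qof: "\<And>e. e \<in> E \<Longrightarrow> Qof e \<in> P \<and> e \<in> Qof e" by metis
  have Qc: "Qof {c, v} \<in> P" "{c, v} \<in> Qof {c, v}" if "v \<in> S" "c \<in> C" for v c
    using edges[OF that] Qof by (auto simp: insert_commute)
  define g where "g v = (\<lambda>c\<in>C. (Qof {c, v}, f c < f v))" for v
  define D where "D = (\<Pi>\<^sub>E c\<in>C. queues_at c \<times> (UNIV :: bool set))"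
  have "g ` S \<subseteq> D"
    using queues_atI[OF Qc] unfolding g_def D_def by (auto simp: restrict_PiE_iff)
  moreover have "finite D"
    unfolding D_def using fin finite_queues_at by (intro finite_PiE finite_cartesian_product) auto
  moreover have "card D \<le> (2 * l) ^ card C"
  proof -
    have "card D = (\<Prod>c\<in>C. card (queues_at c) * 2)"
      unfolding D_def using fin by (simp add: card_PiE card_cartesian_product card_UNIV_bool)
    \<comment> \<open>At most \<open>l\<close> queues at \<open>c\<close>, times two sides.\<close>
    also have "\<dots> \<le> (\<Prod>c\<in>C. 2 * l)"
      by (intro prod_mono) (use card_queues_at C in auto)
    finally show ?thesis by simp
  qed
  then have "card D * 2 < card S"
    using large by (meson le_less_trans mult_le_mono1)
  ultimately obtain y where y: "2 < card {v \<in> S. g v = y}"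
    using large_fibre[OF fin(2)] by metis
  obtain a b d where abd: "a \<in> {v \<in> S. g v = y}" "b \<in> {v \<in> S. g v = y}" "d \<in> {v \<in> S. g v = y}"
    "f a < f b" "f b < f d"
    by (rule three_increasing[OF inj_on_subset[OF inj] y]) (use S in auto)
  define q where "q c = Qof {c, a}" for c
  have same: "Qof {c, v} = q c" "f c < f v \<longleftrightarrow> f c < f a"
    if "c \<in> C" "v \<in> {v \<in> S. g v = y}" for c v
  proof -
    have "g v c = g a c" using that(2) abd(1) by simp
    then show "Qof {c, v} = q c" "f c < f v \<longleftrightarrow> f c < f a"
      using that(1) by (auto simp: g_def q_def)
  qed
  have "homogeneous C q a b d"
    unfolding homogeneous_def
  proof (intro conjI ballI)
    fix c assume c: "c \<in> C"
    show "q c \<in> P" "{c, a} \<in> q c" "{c, b} \<in> q c" "{c, d} \<in> q c"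
      using Qc[OF _ c] same(1)[OF c] abd by (metis mem_Collect_eq)+
    \<comment> \<open>A vertex \<open>c\<close> that is not left of \<open>a\<close> is not left of
      \<open>d\<close> either, so it lies right of \<open>d\<close>.\<close>
    have "f c \<noteq> f d" using c abd(3) S C inj by (auto dest: inj_onD)
    then show "f c < f a \<or> f d < f c" using same(2)[OF c abd(3)] by linarith
  qed (use abd S C in auto)
  with abd that show thesis by blast
qed

text \<open>If \<open>c\<close> precedes \<open>c'\<close> on the left and both had the same queue,
  then \<open>cb\<close> and \<open>c'a\<close> would nest in it.\<close>

lemma homogeneous_inj_left:
  assumes "homogeneous C q a b d"
  shows "inj_on q {c \<in> C. f c < f a}"
proof (rule inj_onI)
  have *: False if "c \<in> C" "c' \<in> C" "f c < f c'" "f c' < f a" "q c = q c'" for c c'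
    using no_nest[of "q c" c b c' a] assms that by (auto simp: homogeneous_def)
  fix c c' assume c: "c \<in> {c \<in> C. f c < f a}" "c' \<in> {c \<in> C. f c < f a}" "q c = q c'"
  then have "f c = f c'" using *[of c c'] *[of c' c] by fastforce
  then show "c = c'" using c assms inj by (auto simp: homogeneous_def dest: inj_onD)
qed

lemma homogeneous_queues:
  assumes "homogeneous C q a b d"
  shows "q ` C \<subseteq> queues_at b"
  using assms queues_atI by (fastforce simp: homogeneous_def insert_commute)

text \<open>The distinct queues of the left vertices all occur at \<open>b\<close>, where there are
  at most \<open>l\<close>.\<close>

lemma homogeneous_card_left:
  assumes "homogeneous C q a b d"
  shows "card {c \<in> C. f c < f a} \<le> l"
proof -
  have "card {c \<in> C. f c < f a} = card (q ` {c \<in> C. f c < f a})"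
    using homogeneous_inj_left[OF assms] by (simp add: card_image)
  also have "\<dots> \<le> card (queues_at b)"
    using homogeneous_queues[OF assms] finite_queues_at by (intro card_mono) auto
  also have "\<dots> \<le> l"
    using card_queues_at assms by (simp add: homogeneous_def)
  finally show ?thesis .
qed

text \<open>Reversal exchanges \<open>a\<close> with \<open>d\<close> and left with right;
  \<open>b\<close> stays in the middle.\<close>

lemma homogeneous_reversed:
  assumes "homogeneous C q a b d"
  shows "ordered_queues.homogeneous V P (\<lambda>x. - f x) C q d b a"
  using assms unfolding homogeneous_def ordered_queues.homogeneous_def[OF reversed] by auto

lemma homogeneous_card_right:
  assumes "homogeneous C q a b d"
  shows "card {c \<in> C. f d < f c} \<le> l"
  using ordered_queues.homogeneous_card_left[OF reversed homogeneous_reversed[OF assms]] by simp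

text \<open>
  If \<open>l\<close> vertices of \<open>C\<close> lie to the left then their queues are all the queues at \<open>b\<close>, so the
  edge \<open>bw\<close> shares a queue with some \<open>ca\<close> and \<open>cd\<close>, and nests with one of them unless \<open>w\<close> is
  to the right of \<open>b\<close>.
\<close>

lemma homogeneous_nbr_right:
  assumes hom: "homogeneous C q a b d" and full: "card {c \<in> C. f c < f a} = l"
    and bw: "{b, w} \<in> E" "w \<notin> C"
  shows "f b < f w"
proof -
  let ?L = "{c \<in> C. f c < f a}"
  have V: "b \<in> V" "w \<in> V" "b \<noteq> w" "C \<subseteq> V"
    using simple_graph_edgeD[OF simple bw(1)] hom by (auto simp: homogeneous_def)
  have "card (q ` ?L) = l" using homogeneous_inj_left[OF hom] full by (simp add: card_image)
  \<comment> \<open>These \<open>l\<close> distinct queues already exhaust the limit at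
    \<open>b\<close>.\<close>
  then have all: "q ` ?L = queues_at b"
    using homogeneous_queues[OF hom] card_queues_at[OF V(1)] finite_queues_at
    by (intro card_seteq) auto
  obtain Q where Q: "Q \<in> P" "{b, w} \<in> Q" using cover bw(1) by blast
  then have "Q \<in> q ` ?L" unfolding all by (rule queues_atI)
  then obtain c where c: "c \<in> C" "f c < f a" "q c = Q" by blast
  have edges: "{c, a} \<in> Q" "{c, d} \<in> Q" and order: "f a < f b" "f b < f d"
    using hom c by (auto simp: homogeneous_def)
  have "f b \<noteq> f w" "f c \<noteq> f w" using V c bw(2) inj by (auto dest: inj_onD)
  \<comment> \<open>Otherwise \<open>wb\<close> would lie inside \<open>cd\<close>; in the next case
    \<open>ca\<close> would lie inside \<open>wb\<close>.\<close>
  moreover have "\<not> (f c < f w \<and> f w < f b)"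
    using no_nest[of Q c d w b] Q edges order by (auto simp: insert_commute)
  moreover have "\<not> f w < f c"
    using no_nest[of Q w b c a] Q edges order c(2) by (auto simp: insert_commute)
  ultimately show ?thesis by linarith
qed

text \<open>If the left were full, exchanging for \<open>b\<close> a vertex \<open>c\<close> of
  \<open>C\<close> that is not on the left would put \<open>l + 1\<close> vertices left of a triple
  of new common neighbours. The supply \<open>W\<close> is assumed for every \<open>c\<close>
  because the layout decides which one is exchanged.\<close>

lemma homogeneous_not_full:
  assumes hom: "homogeneous C q a b d" and C: "l < card C"
    and W: "\<And>c. c \<in> C \<Longrightarrow> \<exists>W \<subseteq> V. W \<inter> insert b C = {} \<and> (2 * l) ^ card C * 2 < card W \<and>
              (\<forall>w\<in>W. \<forall>x\<in>insert b (C - {c}). {w, x} \<in> E)"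
  shows "card {c \<in> C. f c < f a} \<noteq> l"
proof
  let ?L = "{c \<in> C. f c < f a}"
  assume full: "card ?L = l"
  have CV: "C \<subseteq> V" "b \<in> V" "finite C"
    using hom finite_V by (auto simp: homogeneous_def intro: finite_subset)
  have bC: "b \<notin> C" using hom by (force simp: homogeneous_def)
  have "\<not> C \<subseteq> ?L" using C full CV(3) card_mono[of ?L C] by auto
  then obtain c where c: "c \<in> C" "\<not> f c < f a" by blast
  let ?C = "insert b (C - {c})"
  obtain W' where W': "W' \<subseteq> V" "W' \<inter> insert b C = {}" "(2 * l) ^ card C * 2 < card W'"
    "\<forall>w\<in>W'. \<forall>x\<in>?C. {w, x} \<in> E"
    using W[OF c(1)] by blast
  have card: "card ?C = card C"
  proof -
    have "card ?C = Suc (card (C - {c}))" using bC CV(3) by (intro card_insert_disjoint) auto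
    then show ?thesis using card_Suc_Diff1[OF CV(3) c(1)] by (rule trans)
  qed
  obtain q' a' b' d' where a': "a' \<in> W'" and hom': "homogeneous ?C q' a' b' d'"
  proof (rule homogeneous_triple[of W' ?C])
    show "W' \<subseteq> V" "W' \<inter> ?C = {}" "?C \<subseteq> V" using W'(1,2) CV by auto
    show "{w, x} \<in> E" if "w \<in> W'" "x \<in> ?C" for w x using W'(4) that by blast
    show "(2 * l) ^ card ?C * 2 < card W'" unfolding card by (rule W'(3))
  qed (rule that)
  have "f b < f a'"
    using homogeneous_nbr_right[OF hom full, of a'] a' W' by (auto simp: insert_commute)
  moreover have "f a < f b" using hom by (simp add: homogeneous_def)
  \<comment> \<open>The exchange removes no vertex of \<open>?L\<close>, as \<open>c\<close> is not
    in it, and adds \<open>b\<close>.\<close>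
  ultimately have "insert b ?L \<subseteq> {x \<in> ?C. f x < f a'}" using c(2) by auto
  then have "card (insert b ?L) \<le> l"
    using homogeneous_card_left[OF hom'] CV(3) card_mono[of "{x \<in> ?C. f x < f a'}" "insert b ?L"]
    by simp
  then show False using full bC CV(3) by simp
qed

text \<open>Each side has at most \<open>l\<close> vertices of \<open>C\<close>, and together they
  have at least \<open>2 * l - 1\<close>, so one side has exactly \<open>l\<close>. The right side
  is excluded by reversal.\<close>

lemma homogeneous_contradiction:
  assumes hom: "homogeneous C q a b d" and C: "l < card C" "card C = 2 * l \<or> card C + 1 = 2 * l"
    and W: "\<And>c. c \<in> C \<Longrightarrow> \<exists>W \<subseteq> V. W \<inter> insert b C = {} \<and> (2 * l) ^ card C * 2 < card W \<and>
              (\<forall>w\<in>W. \<forall>x\<in>insert b (C - {c}). {w, x} \<in> E)"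
  shows False
proof -
  interpret rev: ordered_queues V E P l "\<lambda>x. - f x" by (rule reversed)
  let ?L = "{c \<in> C. f c < f a}" and ?R = "{c \<in> C. f d < f c}"
  have "finite C" using hom finite_V by (auto simp: homogeneous_def intro: finite_subset)
  moreover have "C = ?L \<union> ?R" "?L \<inter> ?R = {}" using hom by (auto simp: homogeneous_def)
  ultimately have "card C = card ?L + card ?R"
    by (metis card_Un_disjoint finite_Un)
  moreover have "card ?L \<le> l" "card ?R \<le> l"
    using homogeneous_card_left[OF hom] homogeneous_card_right[OF hom] .
  moreover have "card ?L \<noteq> l" using homogeneous_not_full[OF hom C(1) W] by blast
  moreover have "card ?R \<noteq> l"
    using rev.homogeneous_not_full[OF homogeneous_reversed[OF hom] C(1) W] by simp
  ultimately show False using C(2) by linarith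
qed

end

section \<open>From local layouts to integer ranks\<close>

lemma local_layout_ordered_queues:
  assumes simple: "simple_graph V E" and layout: "queue_layout V E r P" "local_layout V P l"
  obtains f where "ordered_queues V E P l f"
proof -
  have lin: "linear_order_on V r" and part: "partition_on E P"
    and queue: "\<And>Q. Q \<in> P \<Longrightarrow> is_queue r Q"
    using layout(1) by (auto simp: queue_layout_def)
  have finV: "finite V" using simple by (simp add: simple_graph_def)
  obtain f :: "'a \<Rightarrow> int" where f: "inj_on f V"
    "\<And>u v. u \<in> V \<Longrightarrow> v \<in> V \<Longrightarrow> f u < f v \<Longrightarrow> precedes r u v"
    using linear_order_rank[OF lin finV] by metis
  have "ordered_queues V E P l f"
  proof
    show "finite P" using finite_elements[OF finite_edges[OF simple] part] .
    show "\<exists>Q\<in>P. e \<in> Q" if "e \<in> E" for e using that part by (auto simp: partition_on_def)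
    show "card {Q \<in> P. \<exists>e\<in>Q. v \<in> e} \<le> l" if "v \<in> V" for v
      using that layout(2) by (simp add: local_layout_def)
    fix Q u v x y assume Q: "Q \<in> P" "{u, v} \<in> Q" "{x, y} \<in> Q" "f u < f x" "f x < f y"
    have "{u, v} \<in> E" "{x, y} \<in> E" using part Q(1-3) by (auto simp: partition_on_def)
    then have V: "u \<in> V" "v \<in> V" "x \<in> V" "y \<in> V"
      using simple_graph_edgeD[OF simple] by blast+
    show "\<not> f y < f v"
    proof
      assume "f y < f v"
      then have "nest r {u, v} {x, y}" unfolding nest_def using f(2) V Q(4,5) by blast
      then show False using queue[OF Q(1)] Q(2,3) by (auto simp: is_queue_def)
    qed
  qed (use simple f in auto)
  with that show thesis .
qed

text \<open>Every edge gets a queue of its own. Hence the minimum in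
  \<open>local_queue_number\<close> is attained.\<close>

lemma ex_queue_layout:
  fixes V :: "'a :: linorder set"
  assumes "simple_graph V E"
  shows "\<exists>l r P. queue_layout V E r P \<and> local_layout V P l"
proof (intro exI conjI)
  let ?r = "{(x, y). x \<in> V \<and> y \<in> V \<and> x \<le> y}" and ?P = "(\<lambda>e. {e}) ` E"
  have lt: "precedes ?r x y \<Longrightarrow> x < y" for x y by (auto simp: precedes_def)
  show "queue_layout V E ?r ?P"
    unfolding queue_layout_def
  proof (intro conjI ballI)
    show "linear_order_on V ?r"
      by (auto simp: linear_order_on_def partial_order_on_def preorder_on_def refl_on_def
          trans_def antisym_def total_on_def)
    show "partition_on E ?P" by (auto simp: partition_on_def disjoint_def)
    fix Q assume "Q \<in> ?P"
    have "\<not> nest ?r e e" for e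
      unfolding nest_def by (auto simp: doubleton_eq_iff dest!: lt)
    then show "is_queue ?r Q" using \<open>Q \<in> ?P\<close> by (auto simp: is_queue_def)
  qed
  show "local_layout V ?P (card ?P)"
    unfolding local_layout_def using finite_edges[OF assms] by (auto intro: card_mono)
qed

section \<open>Choice of the graph and conclusion\<close>

theorem theorem5:
  fixes k :: int
  assumes "k > 1"
  shows "\<exists>(V :: nat set) E. simple_graph V E \<and> int (treewidth V E) = k \<and>
           int (local_queue_number V E) \<ge> \<lceil>real_of_int k / 2\<rceil> + 1"
proof -
  define n where "n = nat k"
  \<comment> \<open>For either parity of \<open>k\<close> this is half of \<open>k\<close>, rounded
    up.\<close>
  define l where "l = (n + 1) div 2"
  \<comment> \<open>One more than the threshold in \<open>homogeneous_triple\<close> for a set of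
    \<open>n\<close> vertices.\<close>
  define M where "M = (2 * l) ^ n * 2 + 1"
  have n: "1 < n" "int n = k" using assms by (auto simp: n_def)
  have l: "l < n" "n = 2 * l \<or> n + 1 = 2 * l" using n(1) by (auto simp: l_def)
  have ceil: "\<lceil>real_of_int k / 2\<rceil> = int l"
    unfolding ceiling_eq_iff using l(2) n(2) by auto
  define C where "C = {..<n}"
  define E0 where "E0 = {e. e \<subseteq> C \<and> card e = 2}"
  have C: "finite C" "card C = n" "clique E0 C" by (auto simp: C_def E0_def clique_def)
  have "tw_at_most n C E0"
    unfolding E0_def using n(1) by (intro tw_at_most_complete) (auto simp: C_def)
  \<comment> \<open>The first round provides the common neighbours of \<open>C\<close>; the second
    provides those of the cliques that arise by exchanging a vertex of \<open>C\<close> for one of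
    them.\<close>
  then obtain V1 E1 where 1: "tw_at_most n V1 E1" "C \<subseteq> V1" "E0 \<subseteq> E1"
    "\<And>K. clique E0 K \<Longrightarrow> K \<subseteq> C \<Longrightarrow> card K = n \<Longrightarrow> new_nbrs M C V1 E1 K"
    using add_common_nbrs_all[of n C E0 M] by metis
  obtain V E where 2: "tw_at_most n V E" "V1 \<subseteq> V" "E1 \<subseteq> E"
    "\<And>K. clique E1 K \<Longrightarrow> K \<subseteq> V1 \<Longrightarrow> card K = n \<Longrightarrow> new_nbrs M V1 V E K"
    using add_common_nbrs_all[OF 1(1), of M] by metis
  obtain S where S: "S \<subseteq> V1 - C" "card S = M" "\<And>v c. v \<in> S \<Longrightarrow> c \<in> C \<Longrightarrow> {v, c} \<in> E1"
    using 1(4)[OF C(3)] C(2) by (auto simp: new_nbrs_def)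
  have simple: "simple_graph V E" using 2(1) by (simp add: tw_at_most_def)
  \<comment> \<open>With \<open>n + 1\<close> vertices this clique forces the treewidth up to
    \<open>n\<close>; its subsets are the cliques needed in the second round.\<close>
  have clique: "clique E1 (insert v C)" if "v \<in> S" for v
    using S(3)[OF that] clique_mono[OF C(3) 1(3)] by (auto simp: clique_def insert_commute)
  have "treewidth V E = n"
  proof -
    have "S \<noteq> {}" using S(2) by (auto simp: M_def)
    then obtain v where v: "v \<in> S" by blast
    show ?thesis
    proof (rule treewidth_eqI[OF 2(1)])
      show "clique E (insert v C)" using clique_mono[OF clique[OF v] 2(3)] .
      show "insert v C \<subseteq> V" using v S(1) 1(2) 2(2) by blast
      have "v \<notin> C" using v S(1) by blast
      then show "card (insert v C) = n + 1" using C by simp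
    qed
  qed
  moreover have "l < local_queue_number V E"
  proof (rule ccontr)
    assume "\<not> l < local_queue_number V E"
    moreover obtain r P where layout: "queue_layout V E r P"
      "local_layout V P (local_queue_number V E)"
      using LeastI_ex[OF ex_queue_layout[OF simple]] unfolding local_queue_number_def by blast
    \<comment> \<open>Locality is monotone in the bound, so an optimal layout is
      \<open>l\<close>-local.\<close>
    ultimately have "local_layout V P l"
      unfolding local_layout_def by (meson le_trans not_less)
    then obtain f where "ordered_queues V E P l f"
      using local_layout_ordered_queues[OF simple layout(1)] by blast
    then interpret ordered_queues V E P l f .
    obtain q a b d where b: "b \<in> S" and hom: "homogeneous C q a b d"
    proof (rule homogeneous_triple[of S C])
      show "S \<subseteq> V" "S \<inter> C = {}" "C \<subseteq> V" using S(1) 1(2) 2(2) by auto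
      show "{v, c} \<in> E" if "v \<in> S" "c \<in> C" for v c using S(3)[OF that] 2(3) by blast
      show "(2 * l) ^ card C * 2 < card S" using S(2) C(2) by (simp add: M_def)
    qed (rule that)
    have bC: "b \<notin> C" "b \<in> V1" using b S(1) by auto
    show False
    proof (rule homogeneous_contradiction[OF hom])
      show "l < card C" "card C = 2 * l \<or> card C + 1 = 2 * l" using l C(2) by auto
      fix c assume c: "c \<in> C"
      let ?K = "insert b (C - {c})"
      have "card ?K = Suc (card (C - {c}))" using bC C(1) by (intro card_insert_disjoint) auto
      then have "card ?K = n" using card_Suc_Diff1[OF C(1) c] C(2) by metis
      moreover have "clique E1 ?K" using clique[OF b] by (auto simp: clique_def)
      moreover have "?K \<subseteq> V1" using bC 1(2) by blast
      ultimately have "new_nbrs M V1 V E ?K" using 2(4) by blast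
      then obtain W where W: "W \<subseteq> V - V1" "card W = M" "\<forall>w\<in>W. \<forall>x\<in>?K. {w, x} \<in> E"
        by (auto simp: new_nbrs_def)
      \<comment> \<open>Second-round vertices lie outside \<open>V1\<close>, whereas
        \<open>C\<close> and \<open>b\<close> lie inside it.\<close>
      moreover have "W \<inter> insert b C = {}" using W(1) bC 1(2) by blast
      moreover have "(2 * l) ^ card C * 2 < card W" using W(2) C(2) by (simp add: M_def)
      ultimately show "\<exists>W \<subseteq> V. W \<inter> insert b C = {} \<and> (2 * l) ^ card C * 2 < card W \<and>
          (\<forall>w\<in>W. \<forall>x\<in>insert b (C - {c}). {w, x} \<in> E)"
        by (intro exI[of _ W]) auto
    qed
  qed
  ultimately show ?thesis using simple n(2) ceil by (intro exI[of _ V] exI[of _ E]) auto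
qed

end
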